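(* Let $(X,f_{1,\infty})$ be a non-autonomous discrete system with $f_{1,\infty}$ feeble open and surjective and converging uniformly to a map $f$, and suppose that $\{f_n^{n+k}\}_{k\in\mathbb{N}}$ converges collectively to $\{f^k\}_{k\in\mathbb{N}}$. If $f_{1,\infty}$ is totally transitive and has dense periodic points, then $f_{1,\infty}$ is weakly mixing.
   Context: $\mathbb{N}=\{1,2,3,\dots\}$. A non-autonomous discrete system $(X,f_{1,\infty})$ consists of a compact metric space $(X,d)$ and a sequence $f_{1,\infty}=\{f_n\}_{n=1}^\infty$ of continuous maps $f_n:X\to X$. For $i,n\in\mathbb{N}$, $f_i^n:=f_{i+(n-1)}\circ\cdots\circ f_i$ (a composition of $n$ maps), and $f_i^0=id_X$. For $s\in\mathbb{N}$, the $s$-th iterate of the system is $f_{1,\infty}^{[s]}:=\{f_{s(n-1)+1}^s\}_{n=1}^\infty$ (so the composition of its first $n$ maps is $f_1^{sn}$). Uniform convergence of $f_{1,\infty}$ to $f:X\to X$ means $D(f_n,f)\to 0$, where $D(g,h)=\sup_{x\in X}d(g(x),h(x))$. "$\{f_n^{n+k}\}_{k\in\mathbb{N}}$ converges collectively to $\{f^k\}_{k\in\mathbb{N}}$" means: for every $\varepsilon>0$ there exists $r_0\in\mathbb{N}$ such that $D(f_r^k,f^k)<\varepsilon$ for all $r\ge r_0$ and all $k\in\mathbb{N}$, where $f_r^k=f_{r+k-1}\circ\cdots\circ f_r$ and $f^k$ is the $k$-fold composition of $f$. $f_{1,\infty}$ is surjective if every $f_i$ is surjective. It is feeble open if $\mathrm{int}(f_i(U))\neq\emptyset$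 for every nonempty open $U\subseteq X$ and every $i\in\mathbb{N}$. The system is transitive if for any two nonempty open subsets $U,V\subseteq X$ there exists $n\in\mathbb{N}$ such that $f_1^n(U)\cap V\neq\emptyset$. It is totally transitive if $f_{1,\infty}^{[s]}$ is transitive for every $s\in\mathbb{N}$. It is weakly mixing if for any four nonempty open subsets $U_1,U_2,V_1,V_2\subseteq X$ there exists $n\in\mathbb{N}$ such that $f_1^n(U_1)\cap V_1\neq\emptyset$ and $f_1^n(U_2)\cap V_2\neq\emptyset$. A point $x\in X$ is $k$-periodic if $f_1^{kn}(x)=x$ for all $n\in\mathbb{N}$; it is periodic if it is $k$-periodic for some $k\in\mathbb{N}$. The system has dense periodic points if its set of periodic points is dense in $X$. *)

theory Defs
  imports "HOL-Analysis.Analysis"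
begin

text \<open>
  The phase space of a non-autonomous discrete system is a type of class \<open>metric_space\<close>
  whose universe is compact. The sequence of maps is indexed by the positive
  integers: a function \<open>f :: nat \<Rightarrow> 'a \<Rightarrow> 'a\<close> stands for \<open>f 1, f 2, \<dots>\<close>, and all indices
  below are guarded so that the value \<open>f 0\<close> is irrelevant.
\<close>

definition nds :: "(nat \<Rightarrow> 'a::metric_space \<Rightarrow> 'a) \<Rightarrow> bool" where
  "nds f \<longleftrightarrow> compact (UNIV :: 'a set) \<and> (\<forall>n\<ge>1. continuous_on UNIV (f n))"

text \<open>\<open>ncomp f i n\<close> is the composition \<open>f (i + n - 1) \<circ> \<dots> \<circ> f i\<close> of \<open>n\<close> maps.\<close>

primrec ncomp :: "(nat \<Rightarrow> 'a \<Rightarrow> 'a) \<Rightarrow> nat \<Rightarrow> nat \<Rightarrow> 'a \<Rightarrow> 'a" where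
  "ncomp f i 0 = id"
| "ncomp f i (Suc n) = f (i + n) \<circ> ncomp f i n"

definition nds_iterate :: "(nat \<Rightarrow> 'a \<Rightarrow> 'a) \<Rightarrow> nat \<Rightarrow> nat \<Rightarrow> 'a \<Rightarrow> 'a" where
  "nds_iterate f s = (\<lambda>n. ncomp f (s * (n - 1) + 1) s)"

text \<open>
  A supremum over the reals: it is the true one on a compact space, where distances are
  bounded.
\<close>

definition sup_dist :: "('a \<Rightarrow> 'a::metric_space) \<Rightarrow> ('a \<Rightarrow> 'a) \<Rightarrow> real" where
  "sup_dist g h = (SUP x. dist (g x) (h x))"

definition converges_uniformly ::
    "(nat \<Rightarrow> 'a::metric_space \<Rightarrow> 'a) \<Rightarrow> ('a \<Rightarrow> 'a) \<Rightarrow> bool" where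
  "converges_uniformly f g \<longleftrightarrow> (\<lambda>n. sup_dist (f n) g) \<longlonglongrightarrow> 0"

definition converges_collectively ::
    "(nat \<Rightarrow> 'a::metric_space \<Rightarrow> 'a) \<Rightarrow> ('a \<Rightarrow> 'a) \<Rightarrow> bool" where
  "converges_collectively f g \<longleftrightarrow>
     (\<forall>\<epsilon>>0. \<exists>r0\<ge>1. \<forall>r\<ge>r0. \<forall>k\<ge>1. sup_dist (ncomp f r k) (g ^^ k) < \<epsilon>)"

definition nds_surjective :: "(nat \<Rightarrow> 'a \<Rightarrow> 'a) \<Rightarrow> bool" where
  "nds_surjective f \<longleftrightarrow> (\<forall>i\<ge>1. surj (f i))"

definition feeble_open :: "(nat \<Rightarrow> 'a::topological_space \<Rightarrow> 'a) \<Rightarrow> bool" where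
  "feeble_open f \<longleftrightarrow> (\<forall>i\<ge>1. \<forall>U. open U \<and> U \<noteq> {} \<longrightarrow> interior (f i ` U) \<noteq> {})"

definition transitive_nds :: "(nat \<Rightarrow> 'a::topological_space \<Rightarrow> 'a) \<Rightarrow> bool" where
  "transitive_nds f \<longleftrightarrow>
     (\<forall>U V. open U \<and> U \<noteq> {} \<and> open V \<and> V \<noteq> {} \<longrightarrow> (\<exists>n\<ge>1. ncomp f 1 n ` U \<inter> V \<noteq> {}))"

definition totally_transitive :: "(nat \<Rightarrow> 'a::topological_space \<Rightarrow> 'a) \<Rightarrow> bool" where
  "totally_transitive f \<longleftrightarrow> (\<forall>s\<ge>1. transitive_nds (nds_iterate f s))"

definition weakly_mixing :: "(nat \<Rightarrow> 'a::topological_space \<Rightarrow> 'a) \<Rightarrow> bool" where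
  "weakly_mixing f \<longleftrightarrow>
     (\<forall>U1 U2 V1 V2.
        open U1 \<and> U1 \<noteq> {} \<and> open U2 \<and> U2 \<noteq> {} \<and> open V1 \<and> V1 \<noteq> {} \<and> open V2 \<and> V2 \<noteq> {} \<longrightarrow>
        (\<exists>n\<ge>1. ncomp f 1 n ` U1 \<inter> V1 \<noteq> {} \<and> ncomp f 1 n ` U2 \<inter> V2 \<noteq> {}))"

definition k_periodic :: "(nat \<Rightarrow> 'a \<Rightarrow> 'a) \<Rightarrow> nat \<Rightarrow> 'a \<Rightarrow> bool" where
  "k_periodic f k x \<longleftrightarrow> (\<forall>n\<ge>1. ncomp f 1 (k * n) x = x)"

definition periodic_points :: "(nat \<Rightarrow> 'a \<Rightarrow> 'a) \<Rightarrow> 'a set" where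
  "periodic_points f = {x. \<exists>k\<ge>1. k_periodic f k x}"

definition dense_periodic_points :: "(nat \<Rightarrow> 'a::topological_space \<Rightarrow> 'a) \<Rightarrow> bool" where
  "dense_periodic_points f \<longleftrightarrow> closure (periodic_points f) = UNIV"

lemma ncomp_add: "ncomp f i (m + n) = ncomp f (i + m) n \<circ> ncomp f i m"
  by (induction n) (auto simp: fun_eq_iff add.assoc)

lemma ncomp_nds_iterate: "ncomp (nds_iterate f s) 1 n = ncomp f 1 (s * n)"
proof (induction n)
  case (Suc n)
  have "ncomp f 1 (s * n + s) = ncomp f (1 + s * n) s \<circ> ncomp f 1 (s * n)"
    by (rule ncomp_add)
  with Suc show ?case
    by (simp add: nds_iterate_def add.commute)
qed simp

end

theory Submission
  imports Defs
begin

text \<open>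
  Write \<open>F n\<close> for \<open>ncomp f 1 n\<close>. Collective convergence transfers transitivity from \<open>f\<close> to the
  limit \<open>g\<close>: a late tail of \<open>f\<close> shadows the iterates of \<open>g\<close>, and hitting times can be made
  arbitrarily late, because a hitting time of an iterate of \<open>f\<close> of order \<open>s\<close> is at least \<open>s\<close>.
  Given open sets \<open>U1\<close>, \<open>U2\<close>, \<open>V1\<close>, \<open>V2\<close>, choose \<open>m\<close> such that some point of \<open>U2\<close> is
  mapped into \<open>V2\<close> by \<open>g ^^ m\<close>; it may be taken periodic for \<open>f\<close>, say with period \<open>p\<close>. At every
  late time \<open>p * j + m\<close> the orbit of this point is in \<open>V2\<close>. Transitivity of the iterate of
  order \<open>p * r\<close>, for large \<open>r\<close>, applied to \<open>U1\<close> and the preimage of (a ball in) \<open>V1\<close> under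
  \<open>g ^^ m\<close>, provides a late \<open>j\<close> for which \<open>F (p * j + m)\<close> also maps a point of \<open>U1\<close> into \<open>V1\<close>.
\<close>

lemma continuous_on_ncomp:
  assumes "nds f" and "i \<ge> 1"
  shows "continuous_on UNIV (ncomp f i n)"
proof (induction n)
  case (Suc n)
  have "continuous_on UNIV (f (i + n))"
    using assms by (simp add: nds_def)
  then have "continuous_on (ncomp f i n ` UNIV) (f (i + n))"
    by (rule continuous_on_subset) simp
  with Suc show ?case
    unfolding ncomp.simps by (rule continuous_on_compose)
qed (simp add: id_def)

lemma surj_ncomp:
  assumes "nds_surjective f" and "i \<ge> 1"
  shows "surj (ncomp f i n)"
proof (induction n)
  case (Suc n)
  moreover have "surj (f (i + n))"
    using assms by (simp add: nds_surjective_def)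
  ultimately show ?case
    unfolding ncomp.simps by (rule comp_surj)
qed simp

lemma dist_le_sup_dist:
  assumes "compact (UNIV :: 'a::metric_space set)"
  shows "dist (g x) (h x :: 'a) \<le> sup_dist g h"
proof -
  have "bounded (UNIV :: 'a set)"
    using assms by (rule compact_imp_bounded)
  then obtain e where "\<And>x y :: 'a. dist x y \<le> e"
    unfolding bounded_two_points by auto
  \<comment> \<open>The real supremum bounds the distances only because they are bounded, which
    compactness ensures.\<close>
  then have "bdd_above (range (\<lambda>x. dist (g x) (h x)))"
    by (intro bdd_aboveI[of _ e]) auto
  then show ?thesis
    unfolding sup_dist_def by (rule cSUP_upper[OF UNIV_I])
qed

text \<open>The case \<open>k = 0\<close> is included, both maps then being the identity, since the
  times \<open>m\<close> found below may be 0.\<close>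

lemma converges_collectivelyE:
  fixes f :: "nat \<Rightarrow> 'a::metric_space \<Rightarrow> 'a"
  assumes "nds f" and "converges_collectively f g" and "e > 0"
  obtains r0 where "r0 \<ge> 1" and "\<And>r k x. r \<ge> r0 \<Longrightarrow> dist (ncomp f r k x) ((g ^^ k) x) < e"
proof -
  obtain r0 where r0: "r0 \<ge> 1" "\<And>r k. r \<ge> r0 \<Longrightarrow> k \<ge> 1 \<Longrightarrow> sup_dist (ncomp f r k) (g ^^ k) < e"
    using assms(2)[unfolded converges_collectively_def, rule_format, OF assms(3)] by auto
  have cpt: "compact (UNIV :: 'a set)"
    using assms(1) by (simp add: nds_def)
  have "dist (ncomp f r k x) ((g ^^ k) x) < e" if "r \<ge> r0" for r k x
  proof (cases "k = 0")
    case False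
    then show ?thesis
      using le_less_trans[OF dist_le_sup_dist[OF cpt] r0(2)[OF that, of k]] by simp
  qed (use assms(3) in simp)
  with r0(1) show ?thesis
    using that by blast
qed

text \<open>For fixed \<open>m\<close>, the continuous maps \<open>ncomp f r m\<close> tend
  uniformly to \<open>g ^^ m\<close> as \<open>r\<close> grows.\<close>

lemma continuous_on_collective_limit:
  assumes "nds f" and "converges_collectively f g"
  shows "continuous_on UNIV (g ^^ m)"
proof (rule uniform_limit_theorem)
  show "\<forall>\<^sub>F r in sequentially. continuous_on UNIV (ncomp f r m)"
    using eventually_ge_at_top[of 1]
    by eventually_elim (rule continuous_on_ncomp[OF assms(1)])
  show "uniform_limit UNIV (\<lambda>r. ncomp f r m) (g ^^ m) sequentially"
  proof (rule uniform_limitI)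
    fix e :: real assume "e > 0"
    obtain r0 where "r0 \<ge> 1" and "\<And>r k x. r \<ge> r0 \<Longrightarrow> dist (ncomp f r k x) ((g ^^ k) x) < e"
      using converges_collectivelyE[OF assms \<open>e > 0\<close>] by auto
    then show "\<forall>\<^sub>F r in sequentially. \<forall>x\<in>UNIV. dist (ncomp f r m x) ((g ^^ m) x) < e"
      unfolding eventually_sequentially by auto
  qed
qed simp

lemma totally_transitiveE:
  assumes "totally_transitive f" and "s \<ge> 1"
    and "open U" "U \<noteq> {}" "open V" "V \<noteq> {}"
  obtains n x where "n \<ge> 1" "x \<in> U" "ncomp f 1 (s * n) x \<in> V"
proof -
  have "transitive_nds (nds_iterate f s)"
    using assms(1,2) by (simp add: totally_transitive_def)
  then obtain n where "n \<ge> 1" "ncomp (nds_iterate f s) 1 n ` U \<inter> V \<noteq> {}"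
    using assms(3-) unfolding transitive_nds_def by blast
  then show ?thesis
    using that unfolding ncomp_nds_iterate by blast
qed

lemma collective_limit_transitive:
  assumes "nds f" and "nds_surjective f" and "converges_collectively f g"
    and "totally_transitive f"
    and "open U" "U \<noteq> {}" "open V" "V \<noteq> {}"
  obtains m x where "x \<in> U" "(g ^^ m) x \<in> V"
proof -
  obtain v where "v \<in> V"
    using assms(8) by auto
  obtain e where "e > 0" and e: "ball v e \<subseteq> V"
    using openE[OF assms(7) \<open>v \<in> V\<close>] .
  obtain r where r: "r \<ge> 1" "\<And>q k x. q \<ge> r \<Longrightarrow> dist (ncomp f q k x) ((g ^^ k) x) < e / 2"
    using converges_collectivelyE[OF assms(1,3), of "e / 2"] \<open>e > 0\<close> by auto
  \<comment> \<open>An orbit starting in \<open>A\<close> is in \<open>U\<close> at time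
    \<open>r\<close>, from where on the maps shadow \<open>g\<close>.\<close>
  define A where "A = ncomp f 1 r -` U"
  have "open A"
    unfolding A_def using assms(5) continuous_on_ncomp[OF assms(1), of 1 r]
    by (intro open_vimage) auto
  moreover have "A \<noteq> {}"
    unfolding A_def using assms(6) surj_ncomp[OF assms(2), of 1 r]
    by (simp add: surj_vimage_empty)
  ultimately obtain n y where n: "n \<ge> 1" "y \<in> A" "ncomp f 1 (r * n) y \<in> ball v (e / 2)"
    using totally_transitiveE[OF assms(4) r(1), of A "ball v (e / 2)"] \<open>e > 0\<close> by auto
  define x where "x = ncomp f 1 r y"
  \<comment> \<open>The subtraction is exact because \<open>n \<ge> 1\<close>.\<close>
  define m where "m = r * n - r"
  have "r * n = r + m"
    using n(1) by (simp add: m_def)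
  then have "ncomp f 1 (r * n) y = ncomp f (1 + r) m x"
    by (simp add: ncomp_add x_def)
  then have "dist v (ncomp f (1 + r) m x) < e / 2"
    using n(3) by simp
  moreover have "dist ((g ^^ m) x) (ncomp f (1 + r) m x) < e / 2"
    by (subst dist_commute, rule r(2)) simp
  ultimately have "dist v ((g ^^ m) x) < e"
    by (rule dist_triangle_half_l)
  then have "(g ^^ m) x \<in> V"
    using e by auto
  moreover have "x \<in> U"
    using n(2) by (simp add: A_def x_def)
  ultimately show ?thesis
    using that by blast
qed

theorem theorem17:
  fixes f :: "nat \<Rightarrow> 'a::metric_space \<Rightarrow> 'a"
    and g :: "'a \<Rightarrow> 'a"
  assumes "nds f"
    and "feeble_open f"
    and "nds_surjective f"
    and "converges_uniformly f g"
    and "converges_collectively f g"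
    and "totally_transitive f"
    and "dense_periodic_points f"
  shows "weakly_mixing f"
  unfolding weakly_mixing_def
proof (intro allI impI, elim conjE)
  fix U1 U2 V1 V2 :: "'a set"
  assume U1: "open U1" "U1 \<noteq> {}" and U2: "open U2" "U2 \<noteq> {}"
    and V1: "open V1" "V1 \<noteq> {}" and V2: "open V2" "V2 \<noteq> {}"
  have preimage_open: "open ((g ^^ m) -` S)" if "open S" for m S
    using that continuous_on_collective_limit[OF assms(1,5)] by (rule open_vimage)
  obtain m z where z: "z \<in> U2" "(g ^^ m) z \<in> V2"
    using collective_limit_transitive[OF assms(1,3,5,6) U2 V2] .
  have "open (U2 \<inter> (g ^^ m) -` V2)"
    using U2(1) preimage_open[OF V2(1)] by auto
  then obtain x where x: "x \<in> U2" "(g ^^ m) x \<in> V2" "x \<in> periodic_points f"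
    using z assms(7) open_Int_closure_eq_empty[of "U2 \<inter> (g ^^ m) -` V2" "periodic_points f"]
    unfolding dense_periodic_points_def by auto
  then obtain p where p: "p \<ge> 1" "\<And>n. n \<ge> 1 \<Longrightarrow> ncomp f 1 (p * n) x = x"
    unfolding periodic_points_def k_periodic_def by auto
  obtain d where d: "d > 0" "ball ((g ^^ m) x) d \<subseteq> V2"
    using openE[OF V2(1) x(2)] .
  obtain v where "v \<in> V1"
    using V1(2) by auto
  obtain e where e: "e > 0" "ball v e \<subseteq> V1"
    using openE[OF V1(1) \<open>v \<in> V1\<close>] .
  \<comment> \<open>The bound \<open>d\<close> keeps the periodic orbit in \<open>V2\<close>;
    \<open>e / 2\<close> is half of the error allowed around \<open>v\<close>.\<close>
  define c where "c = min d (e / 2)"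
  have "c > 0"
    using d(1) e(1) by (simp add: c_def)
  obtain r where r: "r \<ge> 1" "\<And>q k y. q \<ge> r \<Longrightarrow> dist (ncomp f q k y) ((g ^^ k) y) < c"
    using converges_collectivelyE[OF assms(1,5) \<open>c > 0\<close>] by auto
  define B where "B = (g ^^ m) -` ball v (e / 2)"
  \<comment> \<open>\<open>B\<close> is nonempty: a point that the late maps send exactly to
    \<open>v\<close> is sent by \<open>g ^^ m\<close> to within \<open>c \<le> e / 2\<close> of
    \<open>v\<close>.\<close>
  obtain w where "ncomp f r m w = v"
    using surj_ncomp[OF assms(3) r(1)] by (metis surj_def)
  then have "w \<in> B"
    using r(2)[of r m w] by (simp add: B_def c_def)
  moreover have "open B"
    unfolding B_def by (rule preimage_open) simp
  moreover have "p * r \<ge> 1"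
    using p(1) r(1) by simp
  \<comment> \<open>The factor \<open>p\<close> makes the hitting time a multiple of the period of
    \<open>x\<close>; the factor \<open>r\<close> makes it late enough for shadowing.\<close>
  ultimately obtain n y where n: "n \<ge> 1" "y \<in> U1" "ncomp f 1 (p * r * n) y \<in> B"
    using totally_transitiveE[OF assms(6) _ U1, of "p * r" B] by blast
  define s where "s = p * r * n"
  have "s \<ge> r"
    using p(1) n(1) by (simp add: s_def)
  then have close: "dist (ncomp f (1 + s) m u) ((g ^^ m) u) < c" for u
    by (intro r(2)) simp
  have "ncomp f 1 s x = x"
    using p(2)[of "r * n"] r(1) n(1) by (simp add: s_def mult.assoc)
  then have "dist (ncomp f 1 (s + m) x) ((g ^^ m) x) < d"
    using close[of x] by (simp add: ncomp_add c_def)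
  then have "ncomp f 1 (s + m) x \<in> V2"
    using d(2) by (auto simp: dist_commute)
  moreover have "ncomp f 1 (s + m) y \<in> V1"
  proof -
    define u where "u = ncomp f 1 s y"
    have "dist v ((g ^^ m) u) < e / 2"
      using n(3) by (simp add: u_def s_def B_def)
    moreover have "dist (ncomp f (1 + s) m u) ((g ^^ m) u) < e / 2"
      using close[of u] by (simp add: c_def)
    ultimately have "dist v (ncomp f (1 + s) m u) < e"
      by (rule dist_triangle_half_l)
    then show ?thesis
      using e(2) by (auto simp: ncomp_add u_def)
  qed
  moreover have "s + m \<ge> 1"
    using \<open>s \<ge> r\<close> r(1) by simp
  ultimately show "\<exists>n\<ge>1. ncomp f 1 n ` U1 \<inter> V1 \<noteq> {} \<and> ncomp f 1 n ` U2 \<inter> V2 \<noteq> {}"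
    using n(2) x(1) by blast
qed

end
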